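(* Let $X$ be a real Banach space with a Schauder basis, and let $P_n$ denote the projection onto the first $n$ vectors of the basis. Then there exists an equivalent norm $\|\cdot\|$ on $X$ such that for every $x\in X$ with $\|x\|=1$ $$\lim_n\lim_{\varepsilon\to0^+}\sup\{\|2P_ny-y\|:\ y\in X,\ \|y\|\le1,\ \|P_n(x-y)\|\le\varepsilon\}=1.$$
   Context: If $(e_k)$ is the Schauder basis, $P_n(\sum_ka_ke_k)=\sum_{k=1}^na_ke_k$. All norms in the displayed condition are the new equivalent norm $\|\cdot\|$. *)

theory Defs
  imports "HOL-Analysis.Analysis"
begin

definition schauder_basis :: "(nat \<Rightarrow> 'a::real_normed_vector) \<Rightarrow> bool" where
  "schauder_basis e \<longleftrightarrow> (\<forall>x. \<exists>!a :: nat \<Rightarrow> real. (\<lambda>k. a k *\<^sub>R e k) sums x)"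

text \<open>Only meaningful when \<open>e\<close> is a Schauder basis.\<close>

definition schauder_coeff :: "(nat \<Rightarrow> 'a::real_normed_vector) \<Rightarrow> 'a \<Rightarrow> nat \<Rightarrow> real" where
  "schauder_coeff e x = (THE a. (\<lambda>k. a k *\<^sub>R e k) sums x)"

text \<open>The basis is indexed from \<open>0\<close>, so the first \<open>n\<close> basis vectors are \<open>e 0, \<dots>, e (n - 1)\<close>.\<close>

definition schauder_proj :: "(nat \<Rightarrow> 'a::real_normed_vector) \<Rightarrow> nat \<Rightarrow> 'a \<Rightarrow> 'a" where
  "schauder_proj e n x = (\<Sum>k<n. schauder_coeff e x k *\<^sub>R e k)"

definition is_norm :: "('a::real_vector \<Rightarrow> real) \<Rightarrow> bool" where
  "is_norm N \<longleftrightarrow>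
     (\<forall>x. 0 \<le> N x) \<and>
     (\<forall>x. N x = 0 \<longleftrightarrow> x = 0) \<and>
     (\<forall>c x. N (c *\<^sub>R x) = \<bar>c\<bar> * N x) \<and>
     (\<forall>x y. N (x + y) \<le> N x + N y)"

definition equivalent_norm :: "('a::real_normed_vector \<Rightarrow> real) \<Rightarrow> bool" where
  "equivalent_norm N \<longleftrightarrow>
     is_norm N \<and> (\<exists>c C. 0 < c \<and> 0 < C \<and> (\<forall>x. c * norm x \<le> N x \<and> N x \<le> C * norm x))"

end

theory Submission imports Defs begin

text \<open>
  Let \<open>q\<^sub>j x = sup {\<parallel>P\<^sub>m x - P\<^sub>j x\<parallel> : m \<ge> j}\<close> be the oscillation of the partial sums of \<open>x\<close>
  from index \<open>j\<close> on, and take as new norm \<open>N x = (\<Sum>j. 2\<^sup>-\<^sup>j q\<^sub>j x)\<close>. It is equivalent to the given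
  norm because the projections are uniformly bounded. Every \<open>q\<^sub>j\<close>, and so \<open>N\<close>, decreases under
  every \<open>P\<^sub>n\<close>, while \<open>q\<^sub>j x \<rightarrow> 0\<close> as \<open>j \<rightarrow> \<infinity>\<close> for each fixed \<open>x\<close>.

  The norm \<open>N\<close> has a Kadec property: if \<open>N x = 1\<close>, \<open>N y \<le> 1\<close> and \<open>P\<^sub>n y\<close> is close to \<open>P\<^sub>n x\<close> for a
  large \<open>n\<close>, then the tail \<open>y - P\<^sub>n y\<close> is small. The reason is that \<open>N (P\<^sub>n y)\<close> is close to
  \<open>N (P\<^sub>n x)\<close>, which is close to 1, so that passing from \<open>P\<^sub>n y\<close> to \<open>y\<close> adds almost nothing to
  \<open>N\<close>. As no \<open>q\<^sub>j\<close> decreases in this passage, for a fixed \<open>j\<close> also \<open>q\<^sub>j y\<close> is almost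
  \<open>q\<^sub>j (P\<^sub>n y)\<close>, which exceeds \<open>q\<^sub>j x\<close> at most slightly. Since \<open>\<parallel>y - P\<^sub>n y\<parallel> \<le> 2 q\<^sub>j y\<close> for
  \<open>n \<ge> j\<close>, the tail is controlled by \<open>q\<^sub>j x\<close>, and \<open>j\<close> was arbitrary. This is
  \<open>norm_tail_bound\<close>.

  Hence \<open>N (2 P\<^sub>n y - y) \<le> N y + 2 N (P\<^sub>n y - y)\<close> is asymptotically at most 1. The admissible choice
  \<open>y = P\<^sub>n x\<close> gives the value \<open>N (P\<^sub>n x)\<close>, which tends to 1.
\<close>

section \<open>Coefficients and partial sums\<close>

locale schauder =
  fixes e :: "nat \<Rightarrow> 'a::banach"
  assumes basis: "schauder_basis e"
begin

abbreviation coeff :: "'a \<Rightarrow> nat \<Rightarrow> real" where "coeff \<equiv> schauder_coeff e"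
abbreviation P :: "nat \<Rightarrow> 'a \<Rightarrow> 'a" where "P \<equiv> schauder_proj e"

lemma coeff_sums: "(\<lambda>k. coeff x k *\<^sub>R e k) sums x"
  unfolding schauder_coeff_def
  by (rule theI'[where P = "\<lambda>a. (\<lambda>k. a k *\<^sub>R e k) sums x"])
    (use basis in \<open>simp add: schauder_basis_def\<close>)

lemma coeff_eqI: "(\<lambda>k. a k *\<^sub>R e k) sums x \<Longrightarrow> coeff x = a"
  unfolding schauder_coeff_def
  by (rule the1_equality[where P = "\<lambda>a. (\<lambda>k. a k *\<^sub>R e k) sums x"])
    (use basis in \<open>simp_all add: schauder_basis_def\<close>)

lemma coeff_add: "coeff (x + y) = (\<lambda>k. coeff x k + coeff y k)"
  by (rule coeff_eqI) (use sums_add[OF coeff_sums coeff_sums] in \<open>simp add: scaleR_add_left\<close>)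

lemma coeff_scaleR: "coeff (c *\<^sub>R x) = (\<lambda>k. c * coeff x k)"
  by (rule coeff_eqI) (use sums_scaleR_right[OF coeff_sums, of c] in simp)

lemma basis_nonzero: "e k \<noteq> 0"
proof
  assume "e k = 0"
  then have "(\<lambda>i. (if i = k then 1 else 0) *\<^sub>R e i) = (\<lambda>i. 0)" by auto
  then have "coeff 0 = (\<lambda>i. if i = k then 1 else 0)" by (intro coeff_eqI) simp
  moreover have "coeff 0 = (\<lambda>i. 0)" by (intro coeff_eqI) simp
  ultimately show False by (auto dest: fun_cong[where x = k])
qed

lemma linear_proj: "linear (P n)"
  by (rule linearI)
    (simp_all add: schauder_proj_def coeff_add coeff_scaleR scaleR_add_left sum.distrib
      scaleR_sum_right)

lemmas proj_add = linear_add[OF linear_proj]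
  and proj_diff = linear_diff[OF linear_proj]
  and proj_scaleR = linear_cmul[OF linear_proj]
  and proj_0 [simp] = linear_0[OF linear_proj]

lemma proj_zero [simp]: "P 0 x = 0"
  by (simp add: schauder_proj_def)

lemma proj_tendsto: "(\<lambda>n. P n x) \<longlonglongrightarrow> x"
  using coeff_sums[of x] by (simp add: sums_def schauder_proj_def)

lemma coeff_proj: "coeff (P n x) = (\<lambda>k. if k < n then coeff x k else 0)"
proof (rule coeff_eqI)
  have "(\<lambda>k. if k \<in> {..<n} then coeff x k *\<^sub>R e k else 0) sums P n x"
    unfolding schauder_proj_def by (rule sums_If_finite_set) simp
  then show "(\<lambda>k. (if k < n then coeff x k else 0) *\<^sub>R e k) sums P n x"
    by (simp add: if_distrib[of "\<lambda>c. c *\<^sub>R _"] cong: if_cong)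
qed

lemma proj_proj: "P m (P n x) = P (min m n) x"
proof -
  have "P m (P n x) = (\<Sum>k<m. if k \<in> {..<n} then coeff x k *\<^sub>R e k else 0)"
    unfolding schauder_proj_def[of e m] coeff_proj by (intro sum.cong) auto
  also have "\<dots> = P (min m n) x"
    unfolding schauder_proj_def[of e "min m n"]
    by (subst sum.inter_restrict[symmetric]) (auto intro!: sum.cong)
  finally show ?thesis .
qed

section \<open>Uniform boundedness of the partial sum projections\<close>

text \<open>
  This countable subadditivity of \<open>x \<mapsto> sup\<^sub>m \<parallel>P\<^sub>m x\<parallel>\<close> is the completeness of the space under that norm in
  disguise. The \<open>m\<close>-th partial sums of the \<open>y k\<close> add up to vectors \<open>z m\<close> in the span of the
  first \<open>m\<close> basis vectors, with compatible coefficients; the convergence is uniform in \<open>m\<close>, so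
  \<open>z m\<close> tends to \<open>x\<close>, and uniqueness of the expansion identifies \<open>z m\<close> with \<open>P m x\<close>.
\<close>
lemma norm_proj_suminf_le:
  assumes y: "y sums x" and b: "\<And>m k. norm (P m (y k)) \<le> b k" and "summable b"
  shows "norm (P m x) \<le> suminf b"
proof -
  have summable_proj: "summable (\<lambda>k. P m (y k))" for m
    using \<open>summable b\<close> b by (rule summable_comparison_test'[where N = 0])
  have summable_coeff: "summable (\<lambda>k. coeff (y k) i)" for i
  proof (rule summable_comparison_test'[where N = 0])
    show "summable (\<lambda>k. 2 * b k / norm (e i))"
      using \<open>summable b\<close> by (intro summable_divide summable_mult)
    fix k
    have "coeff (y k) i *\<^sub>R e i = P (Suc i) (y k) - P i (y k)"
      by (simp add: schauder_proj_def)
    then have "\<bar>coeff (y k) i\<bar> * norm (e i) = norm (P (Suc i) (y k) - P i (y k))"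
      by (metis norm_scaleR)
    also have "\<dots> \<le> 2 * b k"
      using norm_triangle_ineq4[of "P (Suc i) (y k)" "P i (y k)"] b[of "Suc i" k] b[of i k] by linarith
    finally show "norm (coeff (y k) i) \<le> 2 * b k / norm (e i)"
      using basis_nonzero[of i] by (simp add: pos_le_divide_eq)
  qed
  define z where "z m = (\<Sum>k. P m (y k))" for m
  have z_eq: "z m = (\<Sum>i<m. (\<Sum>k. coeff (y k) i) *\<^sub>R e i)" for m
    unfolding z_def schauder_proj_def
    by (subst suminf_sum)
      (auto intro!: sum.cong suminf_scaleR_left[symmetric] summable_scaleR_left summable_coeff)
  have z_near: "norm (z m - P m (\<Sum>k<n. y k)) \<le> (\<Sum>k. b (k + n))" for m n
  proof -
    have "z m - P m (\<Sum>k<n. y k) = (\<Sum>k. P m (y (k + n)))"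
      unfolding z_def linear_sum[OF linear_proj]
      using suminf_minus_initial_segment[OF summable_proj[of m], of n] by simp
    also have "norm \<dots> \<le> (\<Sum>k. b (k + n))"
      using b \<open>summable b\<close> by (intro norm_suminf_le) (auto simp: summable_iff_shift)
    finally show ?thesis .
  qed
  have "z \<longlonglongrightarrow> x"
  proof (rule metric_LIMSEQ_I)
    fix r :: real assume "0 < r"
    have "(\<lambda>n. \<Sum>k. b (k + n)) \<longlonglongrightarrow> 0"
      using suminf_exist_split2[OF \<open>summable b\<close>] .
    then have "\<forall>\<^sub>F n in sequentially. (\<Sum>k. b (k + n)) < r / 3"
      using \<open>0 < r\<close> by (intro order_tendstoD(2)) auto
    moreover have "\<forall>\<^sub>F n in sequentially. dist (\<Sum>k<n. y k) x < r / 3"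
      using y \<open>0 < r\<close> unfolding sums_def by (intro tendstoD) auto
    ultimately have "\<forall>\<^sub>F n in sequentially. (\<Sum>k. b (k + n)) < r / 3 \<and> dist (\<Sum>k<n. y k) x < r / 3"
      by (rule eventually_conj)
    then obtain n where n: "(\<Sum>k. b (k + n)) < r / 3" "dist (\<Sum>k<n. y k) x < r / 3"
      using eventually_happens'[OF sequentially_bot] by blast
    have "\<forall>\<^sub>F m in sequentially. dist (P m (\<Sum>k<n. y k)) (\<Sum>k<n. y k) < r / 3"
      using proj_tendsto \<open>0 < r\<close> by (intro tendstoD) auto
    then have "\<forall>\<^sub>F m in sequentially. dist (z m) x < r"
    proof eventually_elim
      case (elim m)
      have "dist (z m) x \<le> dist (z m) (P m (\<Sum>k<n. y k))
          + (dist (P m (\<Sum>k<n. y k)) (\<Sum>k<n. y k) + dist (\<Sum>k<n. y k) x)"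
        by (meson add_left_mono dist_triangle order_trans)
      then show ?case
        using elim n z_near[of m n] by (simp add: dist_norm)
    qed
    then show "\<exists>N. \<forall>n\<ge>N. dist (z n) x < r"
      by (simp add: eventually_sequentially)
  qed
  then have "coeff x = (\<lambda>i. \<Sum>k. coeff (y k) i)"
    by (intro coeff_eqI) (simp add: sums_def flip: z_eq)
  then have "P m x = z m"
    unfolding z_eq by (simp add: schauder_proj_def)
  then show ?thesis
    using z_near[of m 0] by simp
qed

lemma bounded_proj: "\<exists>B. \<forall>m. norm (P m x) \<le> B"
  using convergent_imp_Bseq[OF convergentI[OF proj_tendsto]] by (auto simp: Bseq_def)

text \<open>
  The Baire category half of the open mapping argument: the sets on which all projections are bounded
  by \<open>r\<close> exhaust the space, so the closure of one of them contains a ball. By differences the centre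
  moves to the origin, and by scaling every vector is approximable with linear control of the
  projections.
\<close>
lemma proj_dense_bound:
  obtains K where "0 < K"
    "\<And>x \<eta>. 0 < \<eta> \<Longrightarrow> \<exists>y. norm (x - y) < \<eta> \<and> (\<forall>m. norm (P m y) \<le> K * norm x)"
proof -
  define A where "A r = {x. \<forall>m. norm (P m x) \<le> real r}" for r :: nat
  have "(\<Union>r. A r) = UNIV"
  proof -
    have "\<exists>r. x \<in> A r" for x
    proof -
      obtain B where B: "\<And>m. norm (P m x) \<le> B" using bounded_proj by blast
      obtain r where "B \<le> real r" using real_arch_simple by blast
      with B have "x \<in> A r" by (auto simp: A_def intro: order_trans)
      then show ?thesis ..
    qed
    then show ?thesis by auto
  qed
  then have "(\<Union>r. closure (A r)) = UNIV"
    using closure_subset by blast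
  have "\<exists>r. interior (closure (A r)) \<noteq> {}"
  proof (rule ccontr)
    assume "\<not> ?thesis"
    then have "Met_TC.mtopology interior_of \<Union>(range (\<lambda>r. closure (A r))) = {}"
      by (intro Met_TC.metric_Baire_category_alt) (auto simp: complete_UNIV)
    then show False
      using \<open>(\<Union>r. closure (A r)) = UNIV\<close> by simp
  qed
  then obtain r c where "c \<in> interior (closure (A r))" by auto
  then obtain \<delta> where \<delta>: "0 < \<delta>" "ball c \<delta> \<subseteq> closure (A r)"
    by (auto simp: mem_interior)
  have near0: "\<exists>y. norm (x - y) < \<eta> \<and> (\<forall>m. norm (P m y) \<le> 2 * real r)"
    if "norm x < \<delta>" "0 < \<eta>" for x \<eta>
  proof -
    have "c + x \<in> closure (A r)" "c \<in> closure (A r)"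
      using \<delta> that by (auto simp: dist_norm)
    then obtain u v where uv: "u \<in> A r" "v \<in> A r" "dist u (c + x) < \<eta> / 2" "dist v c < \<eta> / 2"
      using \<open>0 < \<eta>\<close> by (meson closure_approachable half_gt_zero)
    have "norm (x - (u - v)) = norm ((v - c) - (u - (c + x)))" by (simp add: algebra_simps)
    also have "\<dots> < \<eta>"
      using uv(3,4) norm_triangle_ineq4[of "v - c" "u - (c + x)"] by (simp add: dist_norm)
    finally have "norm (x - (u - v)) < \<eta>" .
    moreover have "norm (P m (u - v)) \<le> 2 * real r" for m
    proof -
      have "norm (P m (u - v)) \<le> norm (P m u) + norm (P m v)"
        by (simp add: proj_diff norm_triangle_ineq4)
      also have "\<dots> \<le> real r + real r"
        using uv(1,2) by (intro add_mono) (auto simp: A_def)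
      finally show ?thesis by simp
    qed
    ultimately show ?thesis by blast
  qed
  \<comment> \<open>Scaling \<open>x\<close> to norm \<open>\<delta> / 2\<close> turns the bound \<open>2 r\<close> into \<open>2 r\<close> times \<open>2 \<parallel>x\<parallel> / \<delta>\<close>; the successor keeps
    \<open>K\<close> positive if \<open>r = 0\<close>.\<close>
  define K where "K = 4 * real (Suc r) / \<delta>"
  show thesis
  proof
    show "0 < K" using \<delta> by (simp add: K_def)
    fix x :: 'a and \<eta> :: real assume "0 < \<eta>"
    show "\<exists>y. norm (x - y) < \<eta> \<and> (\<forall>m. norm (P m y) \<le> K * norm x)"
    proof (cases "x = 0")
      case True
      then show ?thesis using \<open>0 < \<eta>\<close> by (intro exI[of _ 0]) simp
    next
      case False
      define t where "t = \<delta> / (2 * norm x)"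
      have "0 < t" using False \<delta> by (simp add: t_def)
      have "norm (t *\<^sub>R x) < \<delta>" "0 < t * \<eta>"
        using False \<delta> \<open>0 < t\<close> \<open>0 < \<eta>\<close> by (simp_all add: t_def)
      from near0[OF this] obtain y where
        y: "norm (t *\<^sub>R x - y) < t * \<eta>" "\<And>m. norm (P m y) \<le> 2 * real r" by blast
      have "norm (x - y /\<^sub>R t) = norm ((t *\<^sub>R x - y) /\<^sub>R t)"
        using \<open>0 < t\<close> by (simp add: scaleR_diff_right)
      also have "\<dots> = norm (t *\<^sub>R x - y) / t"
        using \<open>0 < t\<close> by (simp add: divide_inverse_commute)
      also have "\<dots> < \<eta>"
        using y(1) \<open>0 < t\<close> by (simp add: pos_divide_less_eq mult.commute)
      finally have "norm (x - y /\<^sub>R t) < \<eta>" .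
      moreover have "norm (P m (y /\<^sub>R t)) \<le> K * norm x" for m
      proof -
        have "norm (P m (y /\<^sub>R t)) = norm (P m y) / t"
          using \<open>0 < t\<close> by (simp add: proj_scaleR divide_inverse_commute)
        also have "\<dots> \<le> 2 * real (Suc r) / t"
          using y(2)[of m] \<open>0 < t\<close> by (intro divide_right_mono) auto
        also have "\<dots> = K * norm x"
          by (simp add: K_def t_def)
        finally show ?thesis .
      qed
      ultimately show ?thesis by blast
    qed
  qed
qed

text \<open>
  Successive approximation: approximating \<open>x\<close>, then the remainder, and so on, with remainders halved
  each time, writes \<open>x\<close> as a series to which \<open>norm_proj_suminf_le\<close> applies.
\<close>
theorem uniformly_bounded_proj:
  obtains C where "0 < C" "\<And>m x. norm (P m x) \<le> C * norm x"
proof -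
  obtain K where K: "0 < K"
    "\<And>x \<eta>. 0 < \<eta> \<Longrightarrow> \<exists>y. norm (x - y) < \<eta> \<and> (\<forall>m. norm (P m y) \<le> K * norm x)"
    using proj_dense_bound by blast
  define g where "g x \<eta> = (SOME y. norm (x - y) < \<eta> \<and> (\<forall>m. norm (P m y) \<le> K * norm x))" for x \<eta>
  have g: "norm (x - g x \<eta>) < \<eta>" "norm (P m (g x \<eta>)) \<le> K * norm x" if "0 < \<eta>" for x \<eta> m
    using someI_ex[OF K(2)[OF that, of x]] unfolding g_def by blast+
  have "norm (P m x) \<le> 2 * K * norm x" for m x
  proof (cases "x = 0")
    case False
    define \<eta> where "\<eta> k = norm x * (1/2) ^ k" for k :: nat
    have \<eta>_pos: "0 < \<eta> k" for k using False by (simp add: \<eta>_def)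
    define r where "r = rec_nat x (\<lambda>k u. u - g u (\<eta> (Suc k)))"
    define y where "y k = g (r k) (\<eta> (Suc k))" for k
    have r_Suc: "r (Suc k) = r k - y k" for k by (simp add: r_def y_def)
    have r_le: "norm (r k) \<le> \<eta> k" for k
    proof (cases k)
      case 0
      then show ?thesis by (simp add: r_def \<eta>_def)
    next
      case (Suc j)
      then show ?thesis using g(1)[OF \<eta>_pos, of "r j" "Suc j"] by (simp add: r_Suc y_def less_imp_le)
    qed
    have partial: "(\<Sum>k<n. y k) = x - r n" for n
      by (induction n) (simp_all add: r_Suc, simp add: r_def)
    have "\<eta> \<longlonglongrightarrow> 0"
      unfolding \<eta>_def by (intro tendsto_mult_right_zero LIMSEQ_power_zero) simp
    then have "r \<longlonglongrightarrow> 0"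
      by (rule Lim_null_comparison[rotated]) (simp add: r_le)
    then have "y sums x"
      unfolding sums_def partial using tendsto_diff[OF tendsto_const[of x]] by fastforce
    have b: "norm (P m (y k)) \<le> K * norm x * (1/2) ^ k" for m k
    proof -
      have "norm (P m (y k)) \<le> K * norm (r k)"
        unfolding y_def by (rule g(2)[OF \<eta>_pos])
      also have "\<dots> \<le> K * \<eta> k" using r_le K(1) by (intro mult_left_mono) auto
      finally show ?thesis by (simp add: \<eta>_def)
    qed
    have half: "(\<lambda>k. (1/2) ^ k :: real) sums 2"
      using geometric_sums[of "1/2 :: real"] by simp
    have "(\<lambda>k. K * norm x * (1/2) ^ k) sums (K * norm x * 2)"
      by (intro sums_mult half)
    then show ?thesis
      using norm_proj_suminf_le[OF \<open>y sums x\<close> b] by (simp add: sums_iff mult_ac)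
  qed simp
  with K(1) show thesis by (intro that[of "2 * K"]) auto
qed

section \<open>Oscillation of the partial sums\<close>

definition osc :: "nat \<Rightarrow> 'a \<Rightarrow> real" where
  "osc n x = (SUP m\<in>{n..}. norm (P m x - P n x))"

lemma osc_upper: "n \<le> m \<Longrightarrow> norm (P m x - P n x) \<le> osc n x"
proof -
  assume "n \<le> m"
  obtain B where B: "\<And>m. norm (P m x) \<le> B" using bounded_proj by blast
  have "norm (P m x - P n x) \<le> B + B" for m
    using norm_triangle_ineq4[of "P m x" "P n x"] B[of m] B[of n] by linarith
  then show ?thesis
    unfolding osc_def using \<open>n \<le> m\<close> by (intro cSUP_upper bdd_aboveI2) auto
qed

lemma osc_least: "(\<And>m. n \<le> m \<Longrightarrow> norm (P m x - P n x) \<le> B) \<Longrightarrow> osc n x \<le> B"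
  unfolding osc_def by (rule cSUP_least) auto

lemma osc_nonneg: "0 \<le> osc n x"
  using osc_upper[of n n x] by simp

lemma osc_zero [simp]: "osc n 0 = 0"
  by (intro antisym osc_nonneg osc_least) simp

lemma osc_triangle: "osc n (x + y) \<le> osc n x + osc n y"
proof (rule osc_least)
  fix m assume "n \<le> m"
  have "norm (P m (x + y) - P n (x + y)) = norm ((P m x - P n x) + (P m y - P n y))"
    by (simp add: proj_add algebra_simps)
  also have "\<dots> \<le> norm (P m x - P n x) + norm (P m y - P n y)" by (rule norm_triangle_ineq)
  also have "\<dots> \<le> osc n x + osc n y" using \<open>n \<le> m\<close> by (intro add_mono osc_upper)
  finally show "norm (P m (x + y) - P n (x + y)) \<le> osc n x + osc n y" .
qed

lemma osc_scaleR: "osc n (c *\<^sub>R x) = \<bar>c\<bar> * osc n x"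
proof -
  have le: "osc n (c *\<^sub>R x) \<le> \<bar>c\<bar> * osc n x" for c x
  proof (rule osc_least)
    fix m assume "n \<le> m"
    then have "\<bar>c\<bar> * norm (P m x - P n x) \<le> \<bar>c\<bar> * osc n x" by (intro mult_left_mono osc_upper) auto
    then show "norm (P m (c *\<^sub>R x) - P n (c *\<^sub>R x)) \<le> \<bar>c\<bar> * osc n x"
      by (simp add: proj_scaleR flip: scaleR_diff_right)
  qed
  show ?thesis
  proof (cases "c = 0")
    case False
    have "\<bar>c\<bar> * osc n x = \<bar>c\<bar> * osc n (inverse c *\<^sub>R (c *\<^sub>R x))" using False by simp
    also have "\<dots> \<le> \<bar>c\<bar> * (\<bar>inverse c\<bar> * osc n (c *\<^sub>R x))" by (intro mult_left_mono le) simp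
    also have "\<dots> = osc n (c *\<^sub>R x)" using False by (simp flip: mult.assoc)
    finally show ?thesis using le[of c x] by simp
  qed simp
qed

lemma osc_le_osc_0: "osc n x \<le> 2 * osc 0 x"
proof (rule osc_least)
  fix m
  show "norm (P m x - P n x) \<le> 2 * osc 0 x"
    using osc_upper[of 0 m x] osc_upper[of 0 n x] norm_triangle_ineq4[of "P m x" "P n x"] by simp
qed

lemma norm_le_osc_0: "norm x \<le> osc 0 x"
proof (rule LIMSEQ_le_const2)
  show "(\<lambda>m. norm (P m x)) \<longlonglongrightarrow> norm x" by (intro tendsto_norm proj_tendsto)
  show "\<exists>N. \<forall>n\<ge>N. norm (P n x) \<le> osc 0 x" using osc_upper[of 0 _ x] by simp
qed

text \<open>
  Any index \<open>j \<le> n\<close> serves, since both \<open>P n x\<close> and \<open>x\<close> are within the oscillation from \<open>j\<close> of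
  \<open>P j x\<close>. A fixed \<open>j\<close> thus controls the tails at all later \<open>n\<close>.
\<close>
lemma norm_tail_le_osc:
  assumes "j \<le> n"
  shows "norm (P n x - x) \<le> 2 * osc j x"
proof (rule LIMSEQ_le_const2)
  show "(\<lambda>m. norm (P n x - P m x)) \<longlonglongrightarrow> norm (P n x - x)"
    by (intro tendsto_intros proj_tendsto)
  have "norm (P n x - P m x) \<le> 2 * osc j x" if "n \<le> m" for m
    using osc_upper[of j n x] osc_upper[of j m x] assms that
      norm_triangle_ineq4[of "P n x - P j x" "P m x - P j x"] by simp
  then show "\<exists>N. \<forall>m\<ge>N. norm (P n x - P m x) \<le> 2 * osc j x" by blast
qed

lemma osc_tendsto_0: "(\<lambda>n. osc n x) \<longlonglongrightarrow> 0"
proof (rule LIMSEQ_I)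
  fix r :: real assume "0 < r"
  have "Cauchy (\<lambda>n. P n x)"
    using proj_tendsto by (rule LIMSEQ_imp_Cauchy)
  then obtain M where M: "\<And>m n. M \<le> m \<Longrightarrow> M \<le> n \<Longrightarrow> norm (P m x - P n x) < r / 2"
    using CauchyD[of "\<lambda>n. P n x" "r / 2"] \<open>0 < r\<close> by auto
  have "osc n x \<le> r / 2" if "M \<le> n" for n
    using M that by (intro osc_least less_imp_le) auto
  then show "\<exists>N. \<forall>n\<ge>N. norm (osc n x - 0) < r"
    using \<open>0 < r\<close> osc_nonneg by (intro exI[of _ M]) force
qed

text \<open>
  The partial sums of \<open>P n x\<close> are those of \<open>x\<close> stopped at \<open>n\<close>, so they oscillate less.
\<close>
lemma osc_proj_le: "osc j (P n x) \<le> osc j x"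
proof (rule osc_least)
  fix m assume "j \<le> m"
  show "norm (P m (P n x) - P j (P n x)) \<le> osc j x"
  proof (cases "j \<le> n")
    case True
    then show ?thesis using \<open>j \<le> m\<close> osc_upper[of j "min m n" x] by (simp add: proj_proj)
  next
    case False
    then show ?thesis using \<open>j \<le> m\<close> osc_nonneg by (simp add: proj_proj min_def)
  qed
qed

section \<open>The equivalent norm\<close>

definition oscnorm :: "'a \<Rightarrow> real" where
  "oscnorm x = (\<Sum>n. (1/2) ^ n * osc n x)"

lemma summable_osc: "summable (\<lambda>n. (1/2) ^ n * osc n x)"
proof (rule summable_comparison_test'[where N = 0])
  show "summable (\<lambda>n. (1/2) ^ n * (2 * osc 0 x))"
    by (intro summable_mult2 summable_geometric) simp
  show "norm ((1/2) ^ n * osc n x) \<le> (1/2) ^ n * (2 * osc 0 x)" for n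
    using osc_le_osc_0[of n x] osc_nonneg[of n x] by simp
qed

lemma osc_0_le_oscnorm: "osc 0 x \<le> oscnorm x"
  using sum_le_suminf[OF summable_osc, of "{0}" x] osc_nonneg by (simp add: oscnorm_def)

lemma oscnorm_nonneg: "0 \<le> oscnorm x"
  using osc_0_le_oscnorm[of x] osc_nonneg[of 0 x] by simp

lemma norm_le_oscnorm: "norm x \<le> oscnorm x"
  using norm_le_osc_0[of x] osc_0_le_oscnorm[of x] by simp

lemma oscnorm_le_osc_0: "oscnorm x \<le> 4 * osc 0 x"
proof -
  have half: "(\<lambda>k. (1/2) ^ k :: real) sums 2"
    using geometric_sums[of "1/2 :: real"] by simp
  have "oscnorm x \<le> 2 * (2 * osc 0 x)"
    unfolding oscnorm_def
    by (rule sums_le[OF _ summable_sums[OF summable_osc] sums_mult2[OF half]])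
      (simp add: osc_le_osc_0)
  then show ?thesis by simp
qed

lemma oscnorm_triangle: "oscnorm (x + y) \<le> oscnorm x + oscnorm y"
proof -
  have "oscnorm (x + y) \<le> (\<Sum>n. (1/2) ^ n * osc n x + (1/2) ^ n * osc n y)"
    unfolding oscnorm_def
    by (intro suminf_le summable_add summable_osc)
      (simp add: osc_triangle flip: distrib_left)
  also have "\<dots> = oscnorm x + oscnorm y"
    unfolding oscnorm_def by (intro suminf_add[symmetric] summable_osc)
  finally show ?thesis .
qed

lemma oscnorm_scaleR: "oscnorm (c *\<^sub>R x) = \<bar>c\<bar> * oscnorm x"
  unfolding oscnorm_def osc_scaleR
  by (subst suminf_mult[OF summable_osc, symmetric]) (simp add: mult_ac)

lemma oscnorm_upper:
  obtains C where "0 < C" "\<And>x. oscnorm x \<le> C * norm x"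
proof -
  obtain C where C: "0 < C" "\<And>m x. norm (P m x) \<le> C * norm x"
    using uniformly_bounded_proj by blast
  have "oscnorm x \<le> 4 * C * norm x" for x
    using oscnorm_le_osc_0[of x] osc_least[of 0 x "C * norm x"] C(2) by simp
  with C(1) show thesis by (intro that[of "4 * C"]) auto
qed

lemma equivalent_norm_oscnorm: "equivalent_norm oscnorm"
proof -
  have "oscnorm x = 0 \<longleftrightarrow> x = 0" for x
    using norm_le_oscnorm[of x] by (auto simp: oscnorm_def)
  then have "is_norm oscnorm"
    by (simp add: is_norm_def oscnorm_nonneg oscnorm_scaleR oscnorm_triangle)
  moreover obtain C where "0 < C" "\<And>x. oscnorm x \<le> C * norm x"
    using oscnorm_upper by blast
  ultimately show ?thesis
    unfolding equivalent_norm_def using norm_le_oscnorm by (metis mult_1 zero_less_one)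
qed

text \<open>
  All terms of the series for \<open>oscnorm\<close> decrease under \<open>P n\<close>, so the loss in a single term is bounded by
  the total loss.
\<close>
lemma oscnorm_proj_gain:
  "(1/2) ^ j * (osc j x - osc j (P n x)) \<le> oscnorm x - oscnorm (P n x)"
proof -
  have "oscnorm x - oscnorm (P n x) = (\<Sum>i. (1/2) ^ i * osc i x - (1/2) ^ i * osc i (P n x))"
    unfolding oscnorm_def by (intro suminf_diff summable_osc)
  also have "\<dots> \<ge> (\<Sum>i\<in>{j}. (1/2) ^ i * osc i x - (1/2) ^ i * osc i (P n x))"
    by (intro sum_le_suminf summable_diff summable_osc) (auto simp: osc_proj_le)
  finally show ?thesis by (simp add: right_diff_distrib)
qed

lemma oscnorm_proj_le: "oscnorm (P n x) \<le> oscnorm x"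
  unfolding oscnorm_def
  by (intro suminf_le summable_osc mult_left_mono osc_proj_le) simp

lemma osc_le_oscnorm: "osc j x \<le> 2 ^ j * oscnorm x"
proof -
  have "(1/2) ^ j * osc j x \<le> oscnorm x"
    using sum_le_suminf[OF summable_osc, of "{j}" x] osc_nonneg by (simp add: oscnorm_def)
  then have "2 ^ j * ((1/2) ^ j * osc j x) \<le> 2 ^ j * oscnorm x" by (intro mult_left_mono) auto
  then show ?thesis by (simp add: power_one_over)
qed

lemma oscnorm_proj_tendsto: "(\<lambda>n. oscnorm (P n x)) \<longlonglongrightarrow> oscnorm x"
proof -
  obtain C where C: "0 < C" "\<And>x. oscnorm x \<le> C * norm x" using oscnorm_upper by blast
  have "(\<lambda>n. oscnorm x - C * norm (x - P n x)) \<longlonglongrightarrow> oscnorm x - C * norm (x - x)"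
    by (intro tendsto_intros proj_tendsto)
  then have lower: "(\<lambda>n. oscnorm x - C * norm (x - P n x)) \<longlonglongrightarrow> oscnorm x" by simp
  have "oscnorm x - C * norm (x - P n x) \<le> oscnorm (P n x)" for n
    using oscnorm_triangle[of "x - P n x" "P n x"] C(2)[of "x - P n x"] by simp
  then show ?thesis
    by (intro tendsto_sandwich[OF _ _ lower tendsto_const]) (auto simp: oscnorm_proj_le)
qed

text \<open>
  The Kadec property in quantitative form. The bound is small if first \<open>j\<close> is chosen large to make
  \<open>osc j x\<close> small, then \<open>n\<close> large to bring \<open>oscnorm (P n x)\<close> near 1, then \<open>\<epsilon>\<close> small. One
  \<open>\<epsilon>\<close> pays for replacing \<open>P n y\<close> by \<open>P n x\<close> in the norm, the other in the \<open>j\<close>-th oscillation.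
\<close>
lemma norm_tail_bound:
  assumes "j \<le> n" "oscnorm x = 1" "oscnorm y \<le> 1" "oscnorm (P n (x - y)) \<le> \<epsilon>"
  shows "norm (P n y - y) \<le> 2 * (osc j x + 2 ^ j * (1 - oscnorm (P n x) + 2 * \<epsilon>))"
proof -
  have sub: "P n x = P n (x - y) + P n y" "P n y = P n x + (- 1) *\<^sub>R P n (x - y)"
    by (simp_all add: proj_diff)
  have "oscnorm (P n x) \<le> \<epsilon> + oscnorm (P n y)"
    using oscnorm_triangle[of "P n (x - y)" "P n y"] assms(4) sub(1) by simp
  then have "oscnorm y - oscnorm (P n y) \<le> 1 - oscnorm (P n x) + \<epsilon>" using assms(3) by simp
  then have "(1/2) ^ j * (osc j y - osc j (P n y)) \<le> 1 - oscnorm (P n x) + \<epsilon>"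
    using oscnorm_proj_gain[of j y n] by simp
  then have "2 ^ j * ((1/2) ^ j * (osc j y - osc j (P n y))) \<le> 2 ^ j * (1 - oscnorm (P n x) + \<epsilon>)"
    by (intro mult_left_mono) auto
  then have gain: "osc j y - osc j (P n y) \<le> 2 ^ j * (1 - oscnorm (P n x) + \<epsilon>)"
    by (simp add: power_one_over)
  have "osc j (P n y) \<le> osc j (P n x) + osc j (P n (x - y))"
    using osc_triangle[of j "P n x" "(- 1) *\<^sub>R P n (x - y)"] osc_scaleR[of j "- 1" "P n (x - y)"]
      sub(2) by simp
  also have "\<dots> \<le> osc j x + 2 ^ j * \<epsilon>"
  proof (intro add_mono osc_proj_le)
    have "osc j (P n (x - y)) \<le> 2 ^ j * oscnorm (P n (x - y))" by (rule osc_le_oscnorm)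
    also have "\<dots> \<le> 2 ^ j * \<epsilon>" using assms(4) by (intro mult_left_mono) auto
    finally show "osc j (P n (x - y)) \<le> 2 ^ j * \<epsilon>" .
  qed
  finally have "osc j y \<le> osc j x + 2 ^ j * (1 - oscnorm (P n x) + 2 * \<epsilon>)"
    using gain by (simp add: algebra_simps)
  then show ?thesis using norm_tail_le_osc[OF assms(1), of y] by simp
qed

section \<open>Reflections in the partial sum projections\<close>

definition reflection_sup :: "'a \<Rightarrow> nat \<Rightarrow> real \<Rightarrow> ereal" where
  "reflection_sup x n \<epsilon> = (SUP y\<in>{y. oscnorm y \<le> 1 \<and> oscnorm (P n (x - y)) \<le> \<epsilon>}.
     ereal (oscnorm (2 *\<^sub>R P n y - y)))"

text \<open>
  Shrinking \<open>\<epsilon>\<close> shrinks the constraint set, so the supremum is monotone in \<open>\<epsilon>\<close> and its right limit is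
  the infimum.
\<close>
lemma reflection_sup_tendsto:
  "(reflection_sup x n \<longlongrightarrow> (INF \<epsilon>\<in>{0<..}. reflection_sup x n \<epsilon>)) (at_right 0)"
  using Lim_right_bound[of UNIV 0 "reflection_sup x n" "-\<infinity>"]
  by (force simp: reflection_sup_def intro!: SUP_subset_mono)

text \<open>
  The reflection fixes \<open>P n x\<close>, which is admissible for every \<open>\<epsilon> > 0\<close>.
\<close>
lemma reflection_sup_lower:
  assumes "oscnorm x = 1" "0 < \<epsilon>"
  shows "ereal (oscnorm (P n x)) \<le> reflection_sup x n \<epsilon>"
proof -
  have "P n (x - P n x) = 0" by (simp add: proj_diff proj_proj)
  moreover have "oscnorm 0 = 0" by (simp add: oscnorm_def)
  ultimately have "ereal (oscnorm (2 *\<^sub>R P n (P n x) - P n x)) \<le> reflection_sup x n \<epsilon>"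
    unfolding reflection_sup_def using assms oscnorm_proj_le[of n x] by (intro SUP_upper) auto
  then show ?thesis by (simp add: proj_proj scaleR_2)
qed

lemma reflection_sup_upper:
  assumes C: "0 < C" "\<And>x. oscnorm x \<le> C * norm x"
    and "j \<le> n" "oscnorm x = 1"
  shows "reflection_sup x n \<epsilon> \<le> ereal (1 + 4 * C * (osc j x + 2 ^ j * (1 - oscnorm (P n x) + 2 * \<epsilon>)))"
  unfolding reflection_sup_def
proof (rule SUP_least, clarify)
  fix y assume y: "oscnorm y \<le> 1" "oscnorm (P n (x - y)) \<le> \<epsilon>"
  have "oscnorm (2 *\<^sub>R P n y - y) = oscnorm (y + 2 *\<^sub>R (P n y - y))"
    by (simp add: scaleR_diff_right scaleR_2)
  also have "\<dots> \<le> 1 + 2 * oscnorm (P n y - y)"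
    using oscnorm_triangle[of y "2 *\<^sub>R (P n y - y)"] y(1) by (simp add: oscnorm_scaleR)
  also have "\<dots> \<le> 1 + 2 * (C * norm (P n y - y))"
    using C(2)[of "P n y - y"] by simp
  also have "\<dots> \<le> 1 + 2 * (C * (2 * (osc j x + 2 ^ j * (1 - oscnorm (P n x) + 2 * \<epsilon>))))"
    using norm_tail_bound[OF assms(3,4) y] C(1) by simp
  finally show "ereal (oscnorm (2 *\<^sub>R P n y - y))
      \<le> ereal (1 + 4 * C * (osc j x + 2 ^ j * (1 - oscnorm (P n x) + 2 * \<epsilon>)))"
    by (simp add: mult_ac)
qed

text \<open>
  For the upper bound \<open>j\<close> is fixed first. As the infimum over \<open>\<epsilon>\<close> is at most the value at
  \<open>1 / (n + 1)\<close>, the limits in \<open>\<epsilon>\<close> and \<open>n\<close> can then be taken together.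
\<close>
lemma reflection_limit_tendsto:
  assumes x: "oscnorm x = 1"
  shows "(\<lambda>n. INF \<epsilon>\<in>{0<..}. reflection_sup x n \<epsilon>) \<longlonglongrightarrow> 1" (is "?L \<longlonglongrightarrow> 1")
proof (rule order_tendstoI)
  fix a :: ereal assume "a < 1"
  have "(\<lambda>n. ereal (oscnorm (P n x))) \<longlonglongrightarrow> 1"
    using oscnorm_proj_tendsto[of x] x by (simp add: one_ereal_def)
  then have "\<forall>\<^sub>F n in sequentially. a < ereal (oscnorm (P n x))"
    using \<open>a < 1\<close> by (rule order_tendstoD)
  then show "\<forall>\<^sub>F n in sequentially. a < ?L n"
    by eventually_elim
      (use reflection_sup_lower[OF x] in \<open>auto intro!: INF_greatest elim!: less_le_trans\<close>)
next
  fix a :: ereal assume "1 < a"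
  then obtain b where b: "1 < b" "ereal b < a"
    using ereal_dense2[of 1 a] by (auto simp: one_ereal_def)
  obtain C where C: "0 < C" "\<And>x. oscnorm x \<le> C * norm x" using oscnorm_upper by blast
  have "(\<lambda>j. 1 + 4 * C * osc j x) \<longlonglongrightarrow> 1 + 4 * C * 0"
    by (intro tendsto_intros osc_tendsto_0)
  then have "\<forall>\<^sub>F j in sequentially. 1 + 4 * C * osc j x < b"
    using b(1) by (intro order_tendstoD(2)) auto
  then obtain j where j: "1 + 4 * C * osc j x < b"
    using eventually_happens'[OF sequentially_bot] by blast
  define U where "U n = 1 + 4 * C * (osc j x + 2 ^ j * (1 - oscnorm (P n x) + 2 * (1 / real (Suc n))))" for n
  have "U \<longlonglongrightarrow> 1 + 4 * C * (osc j x + 2 ^ j * (1 - oscnorm x + 2 * 0))"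
    unfolding U_def
    by (intro tendsto_intros oscnorm_proj_tendsto LIMSEQ_Suc[OF lim_1_over_n])
  then have "\<forall>\<^sub>F n in sequentially. U n < b"
    using j x by (intro order_tendstoD(2)) auto
  then show "\<forall>\<^sub>F n in sequentially. ?L n < a"
    using eventually_ge_at_top[of j]
  proof eventually_elim
    case (elim n)
    have "?L n \<le> reflection_sup x n (1 / real (Suc n))" by (intro INF_lower) simp
    also have "\<dots> \<le> ereal (U n)"
      unfolding U_def using elim by (intro reflection_sup_upper C x) auto
    also have "\<dots> < ereal b" using elim by simp
    finally show ?case using b(2) by simp
  qed
qed

end

theorem corollary2p13:
  fixes e :: "nat \<Rightarrow> 'a::banach"
  assumes "schauder_basis e"
  shows "\<exists>N :: 'a \<Rightarrow> real. equivalent_norm N \<and>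
    (\<forall>x. N x = 1 \<longrightarrow>
      (\<exists>L :: nat \<Rightarrow> ereal.
        (\<forall>n. ((\<lambda>\<epsilon>::real.
                 SUP y\<in>{y. N y \<le> 1 \<and> N (schauder_proj e n (x - y)) \<le> \<epsilon>}.
                   ereal (N (2 *\<^sub>R schauder_proj e n y - y)))
               \<longlongrightarrow> L n) (at_right 0)) \<and>
        L \<longlonglongrightarrow> 1))"
proof -
  interpret schauder e by (rule schauder.intro) (rule assms)
  show ?thesis
  proof (intro exI[of _ oscnorm] conjI equivalent_norm_oscnorm allI impI)
    fix x assume "oscnorm x = 1"
    then show "\<exists>L. (\<forall>n. ((\<lambda>\<epsilon>. SUP y\<in>{y. oscnorm y \<le> 1 \<and> oscnorm (P n (x - y)) \<le> \<epsilon>}.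
          ereal (oscnorm (2 *\<^sub>R P n y - y))) \<longlongrightarrow> L n) (at_right 0)) \<and> L \<longlonglongrightarrow> 1"
      using reflection_sup_tendsto[of x] reflection_limit_tendsto[of x]
      unfolding reflection_sup_def
      by (intro exI[of _ "\<lambda>n. INF \<epsilon>\<in>{0<..}. reflection_sup x n \<epsilon>"])
        (simp add: reflection_sup_def)
  qed
qed

end
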